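(* Fix integers $q\ge 1$ and $b\in\mathbb{Z}$. Suppose $m$ is a positive integer and $k>0$ is a real number satisfying $$\sum_{\substack{1\le i\le m-1\\ i\equiv b \bmod q}} i^k = m^k,$$ and assume $b\equiv m-r \bmod q$ with $r\in\{1,2,\dots,q\}$. Then $$k = c_1 m + c_2 + O_q(1/m),$$ where $c_1$ is the real solution of $e^{-c_1 q}+e^{-c_1 r}=1$, and $$c_2 = -\frac{c_1}{2}\cdot \frac{\dfrac{r^2}{1-e^{-c_1 q}}+\dfrac{2rq\,e^{-c_1 q}}{(1-e^{-c_1 q})^2}+\dfrac{q^2 e^{-c_1 q}(1+e^{-c_1 q})}{(1-e^{-c_1 q})^3}}{\dfrac{r}{1-e^{-c_1 q}}+\dfrac{q\,e^{-c_1 q}}{(1-e^{-c_1 q})^2}}.$$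
   Context: The notation $O_q(1/m)$ means a quantity bounded in absolute value by $C/m$, where the constant $C$ depends only on $q$; the expansion is asymptotic as $m\to\infty$. The numbers $c_1,c_2$ depend on $q$ and on $r$, where $r$ is the element of $\{1,\dots,q\}$ congruent to $m-b$ modulo $q$. *)

theory Defs
  imports Complex_Main "HOL-Number_Theory.Cong"
begin

text \<open>The definite description is justified by \<open>c1_ex1\<close> below.\<close>

definition c1 :: "nat \<Rightarrow> nat \<Rightarrow> real" where
  "c1 q r = (THE c. exp (- c * real q) + exp (- c * real r) = 1)"

lemma c1_ex1:
  fixes q r :: nat
  assumes "q \<ge> 1" "r \<ge> 1"
  shows "\<exists>!c :: real. exp (- c * real q) + exp (- c * real r) = 1"
proof -
  define f :: "real \<Rightarrow> real" where "f c = exp (- c * real q) + exp (- c * real r)" for c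
  have f_less: "f d < f c" if "c < d" for c d
    using that assms by (auto simp: f_def intro!: add_strict_mono)
  have "exp (- 1) \<le> (1 / 2 :: real)"
    using exp_ge_add_one_self[of "1::real"] by (simp add: exp_minus field_simps)
  moreover have "exp (- real q) \<le> exp (- 1)" "exp (- real r) \<le> exp (- 1)"
    using assms by auto
  ultimately have "f 1 \<le> 1"
    unfolding f_def mult_minus_left mult_1_left by linarith
  moreover have "1 \<le> f 0"
    by (simp add: f_def)
  moreover have "\<forall>x. 0 \<le> x \<and> x \<le> 1 \<longrightarrow> isCont f x"
    unfolding f_def by (auto intro!: continuous_intros)
  ultimately obtain c where "f c = 1"
    using IVT2[of f 1 1 0] by auto
  moreover have "d = c" if "f d = 1" "f c = 1" for d
    using that f_less by (metis less_irrefl linorder_neqE)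
  ultimately have "\<exists>!c. f c = 1"
    by blast
  then show ?thesis
    by (simp add: f_def)
qed

definition c2 :: "nat \<Rightarrow> nat \<Rightarrow> real" where
  "c2 q r =
    (let c = c1 q r; q' = real q; r' = real r; x = exp (- c * q') in
      - (c / 2) *
        ((r'\<^sup>2 / (1 - x) + 2 * r' * q' * x / (1 - x)\<^sup>2 + q'\<^sup>2 * x * (1 + x) / (1 - x) ^ 3)
         / (r' / (1 - x) + q' * x / (1 - x)\<^sup>2)))"

end

theory Submission imports Defs
begin

text \<open>Put \<open>d\<^sub>j = r + q j\<close>; the equation says \<open>F(k) = \<Sum>\<^sub>j (1 - d\<^sub>j/m)\<^sup>k = 1\<close>, the sum over \<open>d\<^sub>j < m\<close>.
  For \<open>k = c m + s\<close> with \<open>c = c1 q r\<close> and \<open>s\<close> bounded, each term is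
  \<open>exp (- c d\<^sub>j) (1 - (s d\<^sub>j + c d\<^sub>j\<^sup>2/2)/m)\<close> up to a summable error of order \<open>1/m\<^sup>2\<close>. With
  \<open>M\<^sub>p = \<Sum>\<^sub>j d\<^sub>j\<^sup>p exp (- c d\<^sub>j)\<close>, the choice of \<open>c\<close> means \<open>M\<^sub>0 = 1\<close>, and \<open>c2 = - (c/2) M\<^sub>2/M\<^sub>1\<close> is the
  value of \<open>s\<close> that kills the \<open>1/m\<close> term. Hence \<open>F(c m + c2 \<plusminus> A/m)\<close> lies on either side of 1 for
  a large constant \<open>A\<close>, and \<open>F\<close> is decreasing, which traps \<open>k\<close>. For the finitely many small \<open>m\<close>,
  the crude bound \<open>k \<le> m\<^sup>2\<close> suffices.\<close>

section \<open>Taylor estimates for a single term of the sum\<close>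

text \<open>The left side without the absolute value has derivative - t^2 / (1 - t), which lies
  between - 2 t^2 and 0 for 0 \<le> t \<le> 1/2. So it decreases, while its sum with t^3 increases,
  and both vanish at 0.\<close>

lemma ln_one_minus_cubic_bound:
  fixes u :: real
  assumes "0 \<le> u" "u \<le> 1 / 2"
  shows "\<bar>ln (1 - u) + u + u\<^sup>2 / 2\<bar> \<le> u ^ 3"
proof -
  define g where "g t = ln (1 - t) + t + t\<^sup>2 / 2" for t :: real
  have der: "(g has_real_derivative - (t\<^sup>2 / (1 - t))) (at t)" if "t < 1" for t
    unfolding g_def using that
    by (auto intro!: derivative_eq_intros simp: field_simps power2_eq_square)
  have "g u \<le> g 0"
  proof (rule DERIV_nonpos_imp_nonincreasing[where f = g])
    fix t assume "0 \<le> t" "t \<le> u"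
    then show "\<exists>y. (g has_real_derivative y) (at t) \<and> y \<le> 0"
      using der[of t] assms by (intro exI[of _ "- (t\<^sup>2 / (1 - t))"]) auto
  qed (use assms in auto)
  moreover have "g 0 + 0 ^ 3 \<le> g u + u ^ 3"
  proof (rule DERIV_nonneg_imp_nondecreasing[where f = "\<lambda>t. g t + t ^ 3"])
    fix t assume t: "0 \<le> t" "t \<le> u"
    have "((\<lambda>t. g t + t ^ 3) has_real_derivative - (t\<^sup>2 / (1 - t)) + 3 * t\<^sup>2) (at t)"
      using der[of t] t assms by (auto intro!: derivative_eq_intros)
    moreover have "t\<^sup>2 / (1 - t) \<le> t\<^sup>2 / (1 / 2)"
      using t assms by (intro divide_left_mono) auto
    then have "t\<^sup>2 / (1 - t) \<le> 2 * t\<^sup>2"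
      by simp
    then have "- (t\<^sup>2 / (1 - t)) + 3 * t\<^sup>2 \<ge> 0"
      using zero_le_power2[of t] by linarith
    ultimately show "\<exists>y. ((\<lambda>t. g t + t ^ 3) has_real_derivative y) (at t) \<and> 0 \<le> y"
      by blast
  qed (use assms in auto)
  ultimately show ?thesis
    using assms by (auto simp: g_def abs_le_iff)
qed

text \<open>From (1 - x) exp x \<le> 1 one gets 0 \<le> exp x - 1 - x \<le> x (exp x - 1), and the
  sign of x decides how this product is bounded. Only an upper bound on x is assumed, because the
  exponents in the application may be very negative.\<close>

lemma exp_minus_linear_bound:
  fixes x S :: real
  assumes "x \<le> S" "0 \<le> S"
  shows "\<bar>exp x - 1 - x\<bar> \<le> x\<^sup>2 * exp S"
proof -
  have "1 - x \<le> exp (- x)"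
    using exp_ge_add_one_self[of "- x"] by simp
  then have "(1 - x) * exp x \<le> 1"
    by (metis exp_gt_zero exp_minus_inverse mult.commute mult_right_mono less_imp_le)
  then have upper: "exp x - 1 \<le> x * exp x"
    by (simp add: algebra_simps)
  have lower: "x \<le> exp x - 1"
    using exp_ge_add_one_self[of x] by linarith
  have "x * (exp x - 1) \<le> x\<^sup>2 * exp S"
  proof (cases "x \<ge> 0")
    case True
    have "x * (exp x - 1) \<le> x * (x * exp x)"
      using upper True by (intro mult_left_mono)
    also have "\<dots> \<le> x * (x * exp S)"
      using True assms by (intro mult_left_mono) auto
    finally show ?thesis
      by (simp add: power2_eq_square mult.assoc)
  next
    case False
    have "x * (exp x - 1) \<le> x * x"
      using lower False by (intro mult_left_mono_neg) auto
    also have "\<dots> \<le> x * x * exp S"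
      using assms by (simp add: mult_le_cancel_left1)
    finally show ?thesis
      by (simp add: power2_eq_square)
  qed
  then show ?thesis
    using upper lower by (simp add: algebra_simps)
qed

text \<open>For d < m the power is exp (- c d) exp x, where x is close to minus the 1/m correction
  \<open>?y\<close>. Expanding the logarithm and then the exponential gives the error for d \<le>
  m/2; larger d, including d \<ge> m, are handled crudely. The bound is uniform in d so that it can
  be summed over a whole progression.\<close>

lemma powr_second_order_approx:
  fixes c s S d m :: real
  assumes c: "0 < c" and s: "\<bar>s\<bar> \<le> S" and d: "1 \<le> d" and m: "1 \<le> m" and k: "0 \<le> c * m + s"
  shows "\<bar>max 0 (1 - d / m) powr (c * m + s) - exp (- c * d) * (1 - (s * d + c * d\<^sup>2 / 2) / m)\<bar>
         \<le> (4 * (exp S + 1 + S + c) + (2 * c + 3 * S)\<^sup>2 * exp S) * (d ^ 6 * exp (- c * d)) / m\<^sup>2"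
    (is "\<bar>?T - _ * (1 - ?y)\<bar> \<le> (?K1 + ?K2) * _ / _")
proof -
  define u where "u = d / m"
  define x where "x = c * d + (c * m + s) * ln (1 - u)"
  have S: "0 \<le> S" using s by linarith
  have u: "0 < u" and dm: "d = u * m" using d m by (auto simp: u_def)
  have T_eq: "?T = exp (- c * d) * exp x" if "u < 1"
    using that by (simp add: u_def[symmetric] powr_def x_def flip: exp_add)
  \<comment> \<open>Because ln (1 - u) \<le> - u and the exponent is nonnegative, the term c d = c m
    u cancels and only - s u remains, where u < 1.\<close>
  have x_le: "x \<le> S" if "u < 1"
  proof -
    have "(c * m + s) * ln (1 - u) \<le> (c * m + s) * (- u)"
      using k that ln_le_minus_one[of "1 - u"] by (intro mult_left_mono) auto
    then have "x \<le> - s * u"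
      by (simp add: x_def dm algebra_simps)
    also have "\<dots> \<le> \<bar>s\<bar> * u"
      using u by (intro mult_right_mono) auto
    also have "\<dots> \<le> S * 1"
      using s that u by (intro mult_mono) auto
    finally show ?thesis by simp
  qed
  have pw: "d ^ i \<le> d ^ j" if "i \<le> j" for i j
    using that d by (rule power_increasing)
  have y_abs: "\<bar>?y\<bar> \<le> (S + c) * d\<^sup>2 / m"
  proof -
    have "\<bar>s * d\<bar> \<le> S * d\<^sup>2"
      unfolding abs_mult using s d pw[of 1 2] S by (intro mult_mono) auto
    moreover have "c * d\<^sup>2 \<ge> 0" using c by simp
    ultimately have "\<bar>s * d + c * d\<^sup>2 / 2\<bar> \<le> (S + c) * d\<^sup>2"
      by (simp add: algebra_simps abs_le_iff)
    then show ?thesis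
      using m by (simp add: abs_divide divide_right_mono)
  qed
  have "\<bar>?T - exp (- c * d) * (1 - ?y)\<bar> \<le> exp (- c * d) * ((?K1 + ?K2) * (d ^ 6 / m\<^sup>2))"
  proof (cases "u \<le> 1 / 2")
    case True
    define p where "p = ln (1 - u) + u + u\<^sup>2 / 2"
    have p: "\<bar>p\<bar> \<le> u ^ 3"
      unfolding p_def using u True by (intro ln_one_minus_cubic_bound) auto
    \<comment> \<open>Inserting ln (1 - u) = - u - u^2 / 2 + p cancels c d, and the contributions -
      s u and - c m u^2 / 2 are exactly - \<open>?y\<close>. What is left has order d^3 /
      m^2.\<close>
    have xy: "x + ?y = - s * u\<^sup>2 / 2 + (c * m + s) * p"
    proof -
      have L: "ln (1 - u) = p - u - u\<^sup>2 / 2" by (simp add: p_def)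
      have "?y = s * u + c * m * u\<^sup>2 / 2"
        unfolding dm using m by (simp add: field_simps power2_eq_square)
      then show ?thesis
        unfolding x_def L by (simp add: dm field_simps power2_eq_square)
    qed
    have u2: "u\<^sup>2 \<le> d ^ 3 / m\<^sup>2"
      unfolding u_def power_divide using pw[of 2 3] by (intro divide_right_mono) auto
    have "\<bar>(c * m + s) * p\<bar> \<le> ((c + S) * m) * u ^ 3"
    proof -
      have "S * 1 \<le> S * m" using m S by (intro mult_left_mono)
      then have "c * m + s \<le> (c + S) * m" using s by (simp add: algebra_simps)
      then show ?thesis
        unfolding abs_mult using k p by (intro mult_mono) auto
    qed
    also have "\<dots> = (c + S) * (d ^ 3 / m\<^sup>2)"
      using m by (simp add: u_def field_simps power2_eq_square power3_eq_cube)
    finally have "\<bar>(c * m + s) * p\<bar> \<le> (c + S) * (d ^ 3 / m\<^sup>2)" .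
    moreover have "\<bar>s * u\<^sup>2\<bar> \<le> S * (d ^ 3 / m\<^sup>2)"
      unfolding abs_mult using s S u2 by (intro mult_mono) auto
    moreover have "\<bar>- s * u\<^sup>2 / 2 + (c * m + s) * p\<bar> \<le> \<bar>s * u\<^sup>2\<bar> + \<bar>(c * m + s) * p\<bar>"
      by simp
    ultimately have "\<bar>x + ?y\<bar> \<le> S * (d ^ 3 / m\<^sup>2) + (c + S) * (d ^ 3 / m\<^sup>2)"
      unfolding xy by linarith
    also have "S * N + (c + S) * N = (c + 2 * S) * N" for N
      by (simp add: algebra_simps)
    finally have xy_abs: "\<bar>x + ?y\<bar> \<le> (c + 2 * S) * (d ^ 3 / m\<^sup>2)" .
    \<comment> \<open>Both \<open>?y\<close> and \<open>x + ?y\<close> are weakened to multiples of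
      d^3 / m. Squaring this in the exponential estimate is the source of d^6 / m^2.\<close>
    have "\<bar>x\<bar> \<le> (2 * c + 3 * S) * (d ^ 3 / m)"
    proof -
      have "(S + c) * d\<^sup>2 / m \<le> (S + c) * (d ^ 3 / m)"
        unfolding times_divide_eq_right[symmetric]
        using S c m pw[of 2 3] by (intro mult_left_mono divide_right_mono) auto
      moreover have "(c + 2 * S) * (d ^ 3 / m\<^sup>2) \<le> (c + 2 * S) * (d ^ 3 / m)"
        using S c m d by (intro mult_left_mono divide_left_mono) (auto simp: power2_eq_square)
      ultimately have "\<bar>?y\<bar> + \<bar>x + ?y\<bar> \<le> (S + c) * (d ^ 3 / m) + (c + 2 * S) * (d ^ 3 / m)"
        using xy_abs y_abs by (meson add_mono order_trans)
      moreover have "\<bar>x\<bar> \<le> \<bar>?y\<bar> + \<bar>x + ?y\<bar>"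
        using abs_triangle_ineq4[of "x + ?y" ?y] by (simp only: add_diff_cancel_right' add.commute)
      ultimately have "\<bar>x\<bar> \<le> (S + c) * (d ^ 3 / m) + (c + 2 * S) * (d ^ 3 / m)"
        by (rule order_trans[rotated])
      also have "(S + c) * N + (c + 2 * S) * N = (2 * c + 3 * S) * N" for N
        by (simp add: algebra_simps)
      finally show ?thesis .
    qed
    then have "x\<^sup>2 \<le> ((2 * c + 3 * S) * (d ^ 3 / m))\<^sup>2"
      by (metis abs_ge_zero power2_abs power_mono)
    also have "\<dots> = (2 * c + 3 * S)\<^sup>2 * (d ^ 6 / m\<^sup>2)"
      by (simp add: power_mult_distrib power_divide flip: power_mult)
    finally have "x\<^sup>2 * exp S \<le> (2 * c + 3 * S)\<^sup>2 * (d ^ 6 / m\<^sup>2) * exp S"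
      by (intro mult_right_mono) auto
    then have "\<bar>exp x - 1 - x\<bar> \<le> ?K2 * (d ^ 6 / m\<^sup>2)"
      using exp_minus_linear_bound[OF x_le S] True by (simp add: mult_ac)
    moreover have "(c + 2 * S) * (d ^ 3 / m\<^sup>2) \<le> ?K1 * (d ^ 6 / m\<^sup>2)"
      using c S pw[of 3 6] d by (intro mult_mono divide_right_mono) (auto simp: add_nonneg_nonneg)
    ultimately have "\<bar>exp x - (1 - ?y)\<bar> \<le> (?K1 + ?K2) * (d ^ 6 / m\<^sup>2)"
      using xy_abs by (simp only: distrib_right)
    moreover have "?T - exp (- c * d) * (1 - ?y) = exp (- c * d) * (exp x - (1 - ?y))"
      using T_eq True by (simp add: algebra_simps)
    ultimately show ?thesis
      by (simp only: abs_mult abs_exp_cancel mult_left_mono exp_ge_zero)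
  next
    case False
    txt \<open>Here \<open>1 \<le> 4 u\<^sup>2\<close>, so the error factor \<open>1/m\<^sup>2\<close> is free and it is enough to bound both terms.\<close>
    define R where "R = (if u < 1 then exp x else 0)"
    \<comment> \<open>For u \<ge> 1 the base is truncated to 0 and \<open>0 powr _ = 0\<close>,
      which is why \<open>R\<close> is 0 there.\<close>
    have T: "?T = exp (- c * d) * R"
      using T_eq by (auto simp: R_def u_def[symmetric])
    have "\<bar>R\<bar> \<le> exp S" using x_le by (auto simp: R_def)
    moreover have "(S + c) * d\<^sup>2 / m \<le> (S + c) * d\<^sup>2 / 1"
      using m S c by (intro divide_left_mono) auto
    then have "\<bar>?y\<bar> \<le> (S + c) * d\<^sup>2"
      using y_abs unfolding div_by_1 by (rule order_trans[rotated])
    moreover have "\<bar>a - (1 - b)\<bar> \<le> A + 1 + B" if "\<bar>a\<bar> \<le> A" "\<bar>b\<bar> \<le> B" for a b A B :: real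
      using that by linarith
    ultimately have "\<bar>R - (1 - ?y)\<bar> \<le> exp S + 1 + (S + c) * d\<^sup>2"
      by blast
    also have "\<dots> \<le> (exp S + 1) * d\<^sup>2 + (S + c) * d\<^sup>2"
      using mult_left_mono[of 1 "d\<^sup>2" "exp S + 1"] d by (simp add: add_nonneg_nonneg)
    also have "\<dots> = (exp S + 1 + S + c) * d\<^sup>2 * 1"
      by (simp add: algebra_simps)
    also have "\<dots> \<le> (exp S + 1 + S + c) * d\<^sup>2 * (4 * u\<^sup>2)"
    proof (rule mult_left_mono)
      have "(1 / 2)\<^sup>2 \<le> u\<^sup>2" using False by (intro power_mono) auto
      then show "1 \<le> 4 * u\<^sup>2" by (simp add: power2_eq_square)
    qed (use S c in auto)
    also have "\<dots> = ?K1 * (d ^ 4 / m\<^sup>2)"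
      by (simp add: u_def power_divide power4_eq_xxxx power2_eq_square algebra_simps add_divide_distrib)
    also have "\<dots> \<le> (?K1 + ?K2) * (d ^ 6 / m\<^sup>2)"
      using c S pw[of 4 6] d by (intro mult_mono divide_right_mono) (auto simp: add_nonneg_nonneg)
    finally show ?thesis
      unfolding T right_diff_distrib[symmetric]
      by (simp only: abs_mult abs_exp_cancel mult_left_mono exp_ge_zero)
  qed
  then show ?thesis by (simp add: mult_ac)
qed

section \<open>Exponential moments of an arithmetic progression\<close>

text \<open>Raising y \<le> exp y to the power p, with y a suitable multiple of d, gives d^p \<le> K
  exp (c d / 2). Half of the decay survives, and d \<ge> j turns it into a geometric series. Using p
  + 1 instead of p in \<open>y\<close> avoids a division by zero at p = 0.\<close>

lemma summable_power_exp_arith_prog: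
  fixes c :: real and q r p :: nat
  assumes "c > 0" "q \<ge> 1"
  shows "summable (\<lambda>j. real (r + q * j) ^ p * exp (- c * real (r + q * j)))"
proof (rule summable_comparison_test)
  define K where "K = (2 * (real p + 1) / c) ^ p"
  show "\<exists>N. \<forall>n\<ge>N. norm (real (r + q * n) ^ p * exp (- c * real (r + q * n))) \<le> K * exp (- c / 2) ^ n"
  proof (intro exI allI impI)
    fix j :: nat
    define d where "d = real (r + q * j)"
    define y where "y = c * d / (2 * (real p + 1))"
    have "j \<le> r + q * j"
      using assms(2) by (cases q) auto
    then have dj: "d \<ge> real j"
      by (simp only: d_def of_nat_le_iff)
    have "y \<le> exp y"
      using exp_ge_add_one_self[of y] by linarith
    then have "y ^ p \<le> exp y ^ p"
      using dj assms by (intro power_mono) (auto simp: y_def)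
    also have "\<dots> = exp (real p * y)"
      by (simp add: exp_of_nat_mult)
    also have "\<dots> \<le> exp (c * d / 2)"
      using dj assms by (auto simp: y_def field_simps)
    finally have "K * y ^ p \<le> K * exp (c * d / 2)"
      using assms by (intro mult_left_mono) (auto simp: K_def)
    moreover have "2 * (real p + 1) / c * y = d"
      using assms by (simp add: y_def add_nonneg_eq_0_iff)
    then have "K * y ^ p = d ^ p"
      by (simp add: K_def flip: power_mult_distrib)
    ultimately have "d ^ p * exp (- c * d) \<le> K * exp (c * d / 2) * exp (- c * d)"
      by (intro mult_right_mono) auto
    also have "\<dots> = K * exp (- c * d / 2)"
      by (simp flip: exp_add)
    also have "\<dots> \<le> K * exp (real j * (- c / 2))"
      using dj assms by (intro mult_left_mono) (auto simp: K_def)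
    finally show "norm (real (r + q * j) ^ p * exp (- c * real (r + q * j))) \<le> K * exp (- c / 2) ^ j"
      using dj unfolding d_def by (simp add: exp_of_nat_mult[symmetric])
  qed
  show "summable (\<lambda>n. K * exp (- c / 2) ^ n)"
    using assms by (intro summable_mult summable_geometric) auto
qed

definition moment :: "real \<Rightarrow> nat \<Rightarrow> nat \<Rightarrow> nat \<Rightarrow> real" where
  "moment c q r p = (\<Sum>j. real (r + q * j) ^ p * exp (- c * real (r + q * j)))"

lemma moment_sums:
  assumes "c > 0" "q \<ge> 1"
  shows "(\<lambda>j. real (r + q * j) ^ p * exp (- c * real (r + q * j))) sums moment c q r p"
  unfolding moment_def by (rule summable_sums[OF summable_power_exp_arith_prog[OF assms]])

lemma moment_split:
  assumes "c > 0" "q \<ge> 1"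
  shows "moment c q r p = real r ^ p * exp (- c * real r) + moment c q (r + q) p"
proof -
  have "(\<lambda>j. real (r + q * Suc j) ^ p * exp (- c * real (r + q * Suc j))) sums moment c q (r + q) p"
    using moment_sums[OF assms, of "r + q" p] by (simp add: add.assoc)
  then show ?thesis
    using sums_unique2[OF moment_sums[OF assms, of r p]]
    by (subst (asm) sums_Suc_iff) (simp add: add.commute)
qed

text \<open>Adding q to each element of the progression multiplies its weight by x and expands (d +
  q)^p binomially. Together with \<open>moment_split\<close> this yields a recursion for the
  moments.\<close>

lemma moment_shift:
  fixes c :: real and q r :: nat
  assumes "c > 0" "q \<ge> 1"
  defines "x \<equiv> exp (- c * real q)"
  shows "moment c q (r + q) 0 = x * moment c q r 0"
    and "moment c q (r + q) 1 = x * (moment c q r 1 + real q * moment c q r 0)"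
    and "moment c q (r + q) 2 = x * (moment c q r 2 + 2 * real q * moment c q r 1 + (real q)\<^sup>2 * moment c q r 0)"
proof -
  note M = moment_sums[OF assms(1,2)]
  have e: "exp (- c * real (r + q + q * j)) = x * exp (- c * real (r + q * j))" for j
    by (simp add: x_def algebra_simps flip: exp_add)
  show "moment c q (r + q) 0 = x * moment c q r 0"
    using M[of "r + q" 0] sums_mult[OF M[of r 0], of x] unfolding e
    by (simp add: sums_unique2)
  have "(\<lambda>j. x * (real (r + q * j) ^ 1 * exp (- c * real (r + q * j))
         + real q * (real (r + q * j) ^ 0 * exp (- c * real (r + q * j)))))
        sums (x * (moment c q r 1 + real q * moment c q r 0))"
    by (intro sums_mult sums_add M)
  also have "(\<lambda>j. x * (real (r + q * j) ^ 1 * exp (- c * real (r + q * j))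
         + real q * (real (r + q * j) ^ 0 * exp (- c * real (r + q * j)))))
       = (\<lambda>j. real (r + q + q * j) ^ 1 * exp (- c * real (r + q + q * j)))"
    unfolding e by (simp add: algebra_simps)
  finally show "moment c q (r + q) 1 = x * (moment c q r 1 + real q * moment c q r 0)"
    using M[of "r + q" 1] by (rule sums_unique2[symmetric])
  have "(\<lambda>j. x * (real (r + q * j) ^ 2 * exp (- c * real (r + q * j))
         + 2 * real q * (real (r + q * j) ^ 1 * exp (- c * real (r + q * j)))
         + (real q)\<^sup>2 * (real (r + q * j) ^ 0 * exp (- c * real (r + q * j)))))
        sums (x * (moment c q r 2 + 2 * real q * moment c q r 1 + (real q)\<^sup>2 * moment c q r 0))"
    by (intro sums_mult sums_add M)
  also have "(\<lambda>j. x * (real (r + q * j) ^ 2 * exp (- c * real (r + q * j))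
         + 2 * real q * (real (r + q * j) ^ 1 * exp (- c * real (r + q * j)))
         + (real q)\<^sup>2 * (real (r + q * j) ^ 0 * exp (- c * real (r + q * j)))))
       = (\<lambda>j. real (r + q + q * j) ^ 2 * exp (- c * real (r + q + q * j)))"
    unfolding e by (simp add: algebra_simps power2_eq_square)
  finally show "moment c q (r + q) 2 = x * (moment c q r 2 + 2 * real q * moment c q r 1 + (real q)\<^sup>2 * moment c q r 0)"
    using M[of "r + q" 2] by (rule sums_unique2[symmetric])
qed

text \<open>Splitting and shifting express (1 - x) times the p-th moment by r^p E and lower moments;
  the equations are solved in the order p = 0, 1, 2. The factors beside E for p = 2 and p = 1 are
  the numerator and denominator in \<open>c2\<close>.\<close>

lemma moment_closed_forms:
  fixes c :: real and q r :: nat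
  assumes "c > 0" "q \<ge> 1"
  defines "x \<equiv> exp (- c * real q)" and "E \<equiv> exp (- c * real r)"
  shows "moment c q r 0 = E / (1 - x)"
    and "moment c q r 1 = E * (real r / (1 - x) + real q * x / (1 - x)\<^sup>2)"
    and "moment c q r 2 = E * ((real r)\<^sup>2 / (1 - x) + 2 * real r * real q * x / (1 - x)\<^sup>2
                               + (real q)\<^sup>2 * x * (1 + x) / (1 - x) ^ 3)"
proof -
  note split = moment_split[OF assms(1,2), of r] and shift = moment_shift[OF assms(1,2), of r, folded x_def]
  have x: "1 - x \<noteq> 0" using assms by simp
  have "(1 - x) * moment c q r 0 = E"
    using split[of 0] unfolding shift by (simp add: E_def algebra_simps)
  then show M0: "moment c q r 0 = E / (1 - x)"
    using x by (simp add: field_simps)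
  have "(1 - x) * moment c q r 1 = real r * E + x * real q * moment c q r 0"
    using split[of 1] unfolding shift by (simp add: E_def algebra_simps)
  then have "moment c q r 1 = (real r * E + x * real q * moment c q r 0) / (1 - x)"
    using x by (simp add: field_simps)
  also have "\<dots> = E * (real r / (1 - x) + real q * x / (1 - x)\<^sup>2)"
    unfolding M0 using x by (simp add: divide_simps) (simp add: algebra_simps power2_eq_square)
  finally show M1: "moment c q r 1 = E * (real r / (1 - x) + real q * x / (1 - x)\<^sup>2)" .
  have "(1 - x) * moment c q r 2 = (real r)\<^sup>2 * E + 2 * x * real q * moment c q r 1 + x * (real q)\<^sup>2 * moment c q r 0"
    using split[of 2] unfolding shift by (simp add: E_def algebra_simps)
  then have "moment c q r 2 = ((real r)\<^sup>2 * E + 2 * x * real q * moment c q r 1 + x * (real q)\<^sup>2 * moment c q r 0) / (1 - x)"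
    using x by (simp add: field_simps)
  also have "\<dots> = E * ((real r)\<^sup>2 / (1 - x) + 2 * real r * real q * x / (1 - x)\<^sup>2
                               + (real q)\<^sup>2 * x * (1 + x) / (1 - x) ^ 3)"
  proof -
    \<comment> \<open>In terms of y = 1 - x all denominators are powers of one variable, so clearing
      them proves the identity.\<close>
    have "(a\<^sup>2 * E + 2 * (1 - y) * b * (E * (a / y + b * (1 - y) / y\<^sup>2)) + (1 - y) * b\<^sup>2 * (E / y)) / y
          = E * (a\<^sup>2 / y + 2 * a * b * (1 - y) / y\<^sup>2 + b\<^sup>2 * (1 - y) * (1 + (1 - y)) / y ^ 3)"
      if "y \<noteq> 0" for a b y :: real
      using that by (simp add: field_simps power2_eq_square power3_eq_cube)
    from this[of "1 - x"] show ?thesis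
      unfolding M0 M1 using x by simp
  qed
  finally show "moment c q r 2 = E * ((real r)\<^sup>2 / (1 - x) + 2 * real r * real q * x / (1 - x)\<^sup>2
                               + (real q)\<^sup>2 * x * (1 + x) / (1 - x) ^ 3)" .
qed

section \<open>The constants \<open>c1\<close> and \<open>c2\<close> in terms of moments\<close>

lemma c1_eq:
  assumes "q \<ge> 1" "r \<ge> 1"
  shows "exp (- c1 q r * real q) + exp (- c1 q r * real r) = 1"
  unfolding c1_def by (rule theI'[OF c1_ex1[OF assms]])

lemma c1_pos:
  assumes "q \<ge> 1" "r \<ge> 1"
  shows "c1 q r > 0"
proof (rule ccontr)
  assume "\<not> ?thesis"
  then have "exp (- c1 q r * real q) \<ge> 1"
    by (simp add: mult_nonpos_nonneg)
  moreover have "exp (- c1 q r * real r) > 0" by simp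
  ultimately show False using c1_eq[OF assms] by linarith
qed

text \<open>The equation defining \<open>c1\<close> says E = 1 - x, so the closed form E / (1 - x)
  equals 1.\<close>

lemma moment0_c1:
  assumes "q \<ge> 1" "r \<ge> 1"
  shows "moment (c1 q r) q r 0 = 1"
proof -
  have "exp (- c1 q r * real r) = 1 - exp (- c1 q r * real q)"
    using c1_eq[OF assms] by linarith
  then show ?thesis
    using moment_closed_forms(1)[OF c1_pos[OF assms] assms(1), of r] c1_pos[OF assms] assms
    by simp
qed

lemma moment1_pos:
  assumes "c > 0" "q \<ge> 1" "r \<ge> 1"
  shows "moment c q r 1 > 0"
proof -
  have "exp (- c * real q) < 1"
    using assms by simp
  then show ?thesis
    unfolding moment_closed_forms(2)[OF assms(1,2)] using assms
    by (intro mult_pos_pos add_pos_nonneg divide_pos_pos divide_nonneg_nonneg) auto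
qed

text \<open>Both closed forms carry the same factor exp (- c1 r), so the quotient in
  \<open>c2\<close> is the second moment over the first.\<close>

lemma c2_moments:
  assumes "q \<ge> 1" "r \<ge> 1"
  shows "c2 q r * moment (c1 q r) q r 1 = - (c1 q r / 2) * moment (c1 q r) q r 2"
proof -
  have cancel: "- (c / 2) * (X / Y) * (E * Y) = - (c / 2) * (E * X)" if "E * Y \<noteq> 0" for c X Y E :: real
    using that by simp
  have "moment (c1 q r) q r 1 \<noteq> 0"
    using moment1_pos[OF c1_pos[OF assms] assms] by simp
  then show ?thesis
    unfolding moment_closed_forms(2,3)[OF c1_pos[OF assms] assms(1)] c2_def Let_def
    by (rule cancel)
qed

section \<open>The normalised power sum: monotonicity, crude bound and expansion\<close>

text \<open>Cutting off with \<open>max 0\<close> (and \<open>0 powr k = 0\<close>) lets the sum range over all \<open>j\<close>, so it can be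
  compared termwise with the moments.\<close>
definition power_sum_ratio :: "nat \<Rightarrow> nat \<Rightarrow> nat \<Rightarrow> real \<Rightarrow> real" where
  "power_sum_ratio q r m k = (\<Sum>j. max 0 (1 - real (r + q * j) / real m) powr k)"

lemma arith_prog_below:
  fixes q r m :: nat
  assumes "q \<ge> 1"
  shows "{j. r + q * j < m} \<subseteq> {..<m}"
proof
  fix j assume "j \<in> {j. r + q * j < m}"
  moreover have "j \<le> q * j"
    using assms by (cases q) auto
  ultimately show "j \<in> {..<m}" unfolding mem_Collect_eq lessThan_iff by linarith
qed

lemma power_sum_ratio_sums:
  assumes "q \<ge> 1" "m > 0"
  shows "(\<lambda>j. max 0 (1 - real (r + q * j) / real m) powr k) sums power_sum_ratio q r m k"
    and "power_sum_ratio q r m k = (\<Sum>j | r + q * j < m. (1 - real (r + q * j) / real m) powr k)"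
proof -
  have "finite {j. r + q * j < m}"
    using arith_prog_below[OF assms(1)] by (rule finite_subset) simp
  moreover have "max 0 (1 - real (r + q * j) / real m) = 0" if "\<not> r + q * j < m" for j
  proof -
    have "real m \<le> real (r + q * j)" using that by (simp only: of_nat_le_iff)
    then show ?thesis using assms by (simp add: field_simps max_def)
  qed
  ultimately have S: "(\<lambda>j. max 0 (1 - real (r + q * j) / real m) powr k) sums
      (\<Sum>j | r + q * j < m. max 0 (1 - real (r + q * j) / real m) powr k)"
    by (intro sums_finite) auto
  then show "(\<lambda>j. max 0 (1 - real (r + q * j) / real m) powr k) sums power_sum_ratio q r m k"
    unfolding power_sum_ratio_def using sums_unique by force
  show "power_sum_ratio q r m k = (\<Sum>j | r + q * j < m. (1 - real (r + q * j) / real m) powr k)"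
    unfolding power_sum_ratio_def sums_unique[OF S, symmetric]
  proof (intro sum.cong refl)
    fix j assume "j \<in> {j. r + q * j < m}"
    then have "real (r + q * j) < real m" by (simp only: of_nat_less_iff mem_Collect_eq)
    then have "0 \<le> 1 - real (r + q * j) / real m" using assms by (simp add: field_simps)
    then show "max 0 (1 - real (r + q * j) / real m) powr k = (1 - real (r + q * j) / real m) powr k"
      by (simp only: max_absorb2)
  qed
qed

lemma power_sum_ratio_antimono:
  assumes "q \<ge> 1" "r \<ge> 1" "m > 0" "k \<le> k'"
  shows "power_sum_ratio q r m k' \<le> power_sum_ratio q r m k"
  unfolding power_sum_ratio_sums(2)[OF assms(1,3)]
proof (rule sum_mono)
  fix j assume "j \<in> {j. r + q * j < m}"
  then have "real (r + q * j) < real m" by (simp only: of_nat_less_iff mem_Collect_eq)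
  then show "(1 - real (r + q * j) / real m) powr k' \<le> (1 - real (r + q * j) / real m) powr k"
    using assms by (intro powr_mono') (auto simp: field_simps)
qed

text \<open>There are at most m terms, and each has r + q j \<ge> 1, hence base at most 1 - 1/m
  \<le> exp (- 1/m). This serves to bound k when m is small.\<close>

lemma power_sum_ratio_le:
  assumes "q \<ge> 1" "r \<ge> 1" "m > 0" "k > 0"
  shows "power_sum_ratio q r m k \<le> real m * exp (- k / real m)"
proof -
  have "power_sum_ratio q r m k \<le> (\<Sum>j | r + q * j < m. exp (- k / real m))"
    unfolding power_sum_ratio_sums(2)[OF assms(1,3)]
  proof (rule sum_mono)
    fix j assume "j \<in> {j. r + q * j < m}"
    then have d: "real (r + q * j) < real m" by (simp only: of_nat_less_iff mem_Collect_eq)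
    have "1 \<le> real (r + q * j)"
      using assms(2) by (metis of_nat_1 of_nat_le_iff trans_le_add1)
    then have "1 - real (r + q * j) / real m \<le> 1 - 1 / real m"
      by (intro diff_left_mono divide_right_mono) auto
    also have "\<dots> \<le> exp (- 1 / real m)"
      using exp_ge_add_one_self[of "- 1 / real m"] by simp
    finally have "1 - real (r + q * j) / real m \<le> exp (- 1 / real m)" .
    moreover have "0 \<le> 1 - real (r + q * j) / real m"
      using d assms(3) by (simp add: field_simps)
    ultimately have "(1 - real (r + q * j) / real m) powr k \<le> exp (- 1 / real m) powr k"
      using assms(4) by (intro powr_mono2) auto
    then show "(1 - real (r + q * j) / real m) powr k \<le> exp (- k / real m)"
      by (simp add: powr_def)
  qed
  also have "\<dots> = real (card {j. r + q * j < m}) * exp (- k / real m)"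
    by simp
  also have "\<dots> \<le> real m * exp (- k / real m)"
    using card_mono[OF _ arith_prog_below[OF assms(1)], of m r] by (intro mult_right_mono) auto
  finally show ?thesis .
qed

text \<open>The termwise estimate is summed over j; its factor d^6 exp (- c d) produces the sixth
  moment in \<open>K\<close>.\<close>

lemma power_sum_ratio_approx:
  fixes q r m :: nat and s S :: real
  assumes "q \<ge> 1" "r \<ge> 1" "m > 0"
  defines "c \<equiv> c1 q r"
  assumes s: "\<bar>s\<bar> \<le> S" and k: "0 \<le> c * real m + s"
  defines "K \<equiv> (4 * (exp S + 1 + S + c) + (2 * c + 3 * S)\<^sup>2 * exp S) * moment c q r 6"
  shows "\<bar>power_sum_ratio q r m (c * real m + s) - 1 + (s - c2 q r) * moment c q r 1 / real m\<bar> \<le> K / (real m)\<^sup>2"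
proof -
  have c: "c > 0" unfolding c_def by (rule c1_pos[OF assms(1,2)])
  define d where "d j = real (r + q * j)" for j
  define K0 where "K0 = 4 * (exp S + 1 + S + c) + (2 * c + 3 * S)\<^sup>2 * exp S"
  \<comment> \<open>The termwise error is written as a combination of moment summands, so that its
    sum can be read off from the moments.\<close>
  define \<delta> where "\<delta> j = max 0 (1 - d j / real m) powr (c * real m + s)
      - (d j ^ 0 * exp (- c * d j) - (s * (d j ^ 1 * exp (- c * d j)) + c / 2 * (d j ^ 2 * exp (- c * d j))) / real m)" for j
  note M = moment_sums[OF c assms(1), of r, folded d_def]
  have d1: "d j \<ge> 1" for j
    unfolding d_def using assms(2) by (metis of_nat_1 of_nat_le_iff trans_le_add1)
  have le: "\<bar>\<delta> j\<bar> \<le> K0 * (d j ^ 6 * exp (- c * d j)) / (real m)\<^sup>2" for j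
  proof -
    have "\<delta> j = max 0 (1 - d j / real m) powr (c * real m + s)
        - exp (- c * d j) * (1 - (s * d j + c * (d j)\<^sup>2 / 2) / real m)"
      unfolding \<delta>_def using assms(3) by (simp add: field_simps)
    then show ?thesis
      using powr_second_order_approx[OF c s d1 _ k, of j] assms(3) by (simp add: K0_def)
  qed
  have Ksums: "(\<lambda>j. K0 * (d j ^ 6 * exp (- c * d j)) / (real m)\<^sup>2) sums (K / (real m)\<^sup>2)"
    unfolding K_def K0_def by (intro sums_mult sums_divide M)
  have "\<delta> sums (power_sum_ratio q r m (c * real m + s)
      - (moment c q r 0 - (s * moment c q r 1 + c / 2 * moment c q r 2) / real m))"
    unfolding \<delta>_def
    by (intro sums_diff sums_add sums_mult sums_divide M
        power_sum_ratio_sums(1)[OF assms(1,3), of r, folded d_def])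
  also have "c / 2 * moment c q r 2 = - c2 q r * moment c q r 1"
    using c2_moments[OF assms(1,2), folded c_def] by simp
  also have "moment c q r 0 = 1"
    unfolding c_def by (rule moment0_c1[OF assms(1,2)])
  finally have D: "\<delta> sums (power_sum_ratio q r m (c * real m + s) - 1 + (s - c2 q r) * moment c q r 1 / real m)"
    by (simp add: algebra_simps add_divide_distrib diff_divide_distrib)
  have "\<bar>suminf \<delta>\<bar> \<le> (\<Sum>j. K0 * (d j ^ 6 * exp (- c * d j)) / (real m)\<^sup>2)"
  proof -
    have "summable (\<lambda>j. \<bar>\<delta> j\<bar>)"
      using le by (intro summable_comparison_test'[OF sums_summable[OF Ksums], of 0]) auto
    from order_trans[OF summable_rabs[OF this] suminf_le[OF le this sums_summable[OF Ksums]]]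
    show ?thesis .
  qed
  then show ?thesis
    unfolding sums_unique[OF D, symmetric] sums_unique[OF Ksums, symmetric] .
qed

section \<open>Trapping the solution k\<close>

lemma power_sum_ratio_eq_1_asymp:
  fixes q r :: nat
  assumes q: "q \<ge> 1" and r: "r \<ge> 1"
  shows "\<exists>C. \<forall>m k. m > 0 \<longrightarrow> k > 0 \<longrightarrow> power_sum_ratio q r m k = 1 \<longrightarrow>
           \<bar>k - (c1 q r * real m + c2 q r)\<bar> \<le> C / real m"
proof -
  define c S D where "c = c1 q r" and "S = \<bar>c2 q r\<bar> + 1" and "D = moment c q r 1"
  define K where "K = (4 * (exp S + 1 + S + c) + (2 * c + 3 * S)\<^sup>2 * exp S) * moment c q r 6"
  have c: "c > 0" unfolding c_def by (rule c1_pos[OF q r])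
  have D: "D > 0" unfolding D_def by (rule moment1_pos[OF c q r])
  \<comment> \<open>\<open>A\<close> is large enough that the linear term A D / m^2 at the test
    points c m + c2 \<plusminus> A/m beats the error K / m^2.\<close>
  define A where "A = (\<bar>K\<bar> + 1) / D"
  have A: "A > 0" "K < A * D" using D by (auto simp: A_def add_nonneg_pos)
  \<comment> \<open>For m \<ge> A the test offsets c2 \<plusminus> A/m stay within \<open>S\<close>,
    and for m \<ge> S/c the exponent c m + s is nonnegative. The second entry of the maximum
    \<open>C\<close> covers the remaining m < B.\<close>
  define B where "B = max A (S / c)"
  define C where "C = max A (B * (B\<^sup>2 + c * B + S))"
  have approx: "\<bar>power_sum_ratio q r m (c * real m + s) - 1 + (s - c2 q r) * D / real m\<bar> \<le> K / (real m)\<^sup>2"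
    if "m > 0" "real m \<ge> B" "\<bar>s\<bar> \<le> S" for m :: nat and s
  proof -
    have "S \<le> c * real m" using that(2) c by (simp add: B_def field_simps)
    then show ?thesis
      unfolding c_def K_def D_def
      using that(3) by (intro power_sum_ratio_approx[OF q r that(1)]) (auto simp: c_def)
  qed
  show ?thesis
  proof (intro exI[of _ C] allI impI)
    fix m :: nat and k :: real
    assume m: "m > 0" and k: "k > 0" and eq: "power_sum_ratio q r m k = 1"
    show "\<bar>k - (c1 q r * real m + c2 q r)\<bar> \<le> C / real m"
    proof (cases "real m \<ge> B")
      case True
      then have Am: "\<bar>A / real m\<bar> \<le> 1" using m A by (simp add: B_def)
      have lt: "K / (real m)\<^sup>2 < A * D / (real m)\<^sup>2"
        using A m by (simp add: divide_strict_right_mono)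
      have "\<bar>c2 q r + A / real m\<bar> \<le> S" "\<bar>c2 q r - A / real m\<bar> \<le> S"
        unfolding S_def using Am by linarith+
      note approx' = this[THEN approx[OF m True]]
      have shift: "(c2 q r + A / real m - c2 q r) * D / real m = A * D / (real m)\<^sup>2"
        "(c2 q r - A / real m - c2 q r) * D / real m = - (A * D / (real m)\<^sup>2)"
        by (auto simp: power2_eq_square)
      have "power_sum_ratio q r m (c * real m + (c2 q r + A / real m)) < 1"
        using approx'(1) lt unfolding shift by linarith
      then have "k < c * real m + (c2 q r + A / real m)"
        using power_sum_ratio_antimono[OF q r m] eq by (metis not_less)
      moreover have "power_sum_ratio q r m (c * real m + (c2 q r - A / real m)) > 1"
        using approx'(2) lt unfolding shift by linarith
      then have "k > c * real m + (c2 q r - A / real m)"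
        using power_sum_ratio_antimono[OF q r m] eq by (metis not_less)
      moreover have "A / real m \<le> C / real m"
        by (intro divide_right_mono) (auto simp: C_def)
      ultimately show ?thesis by (simp add: c_def abs_le_iff)
    next
      case False
      have "1 \<le> real m * exp (- k / real m)"
        using power_sum_ratio_le[OF q r m k] eq by simp
      then have "exp (k / real m) \<le> real m"
        by (simp add: exp_minus field_simps)
      moreover have "k / real m \<le> exp (k / real m)"
        using exp_ge_add_one_self[of "k / real m"] by linarith
      ultimately have "k / real m \<le> real m" by linarith
      then have "k \<le> (real m)\<^sup>2"
        using m by (simp add: field_simps power2_eq_square)
      also have "\<dots> \<le> B\<^sup>2" using False by (intro power_mono) auto
      finally have "k \<le> B\<^sup>2" .
      moreover have "c * real m \<le> c * B" "0 \<le> c * real m" using False c by auto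
      ultimately have "\<bar>k - (c * real m + c2 q r)\<bar> \<le> B\<^sup>2 + c * B + S"
        using k zero_le_power2[of B] unfolding S_def by linarith
      then have "real m * \<bar>k - (c * real m + c2 q r)\<bar> \<le> B * (B\<^sup>2 + c * B + S)"
        using False by (intro mult_mono) auto
      also have "\<dots> \<le> C" by (simp add: C_def)
      finally show ?thesis using m by (simp add: c_def field_simps)
    qed
  qed
qed

section \<open>From the original equation to the normalised sum\<close>

text \<open>The substitution i = m - (r + q j) runs through the residue class of b below m, since b
  is congruent to m - r; then m^k is factored out.\<close>

lemma power_sum_eq_ratio:
  fixes b :: int and q r m :: nat
  assumes q: "q \<ge> 1" and r: "r \<in> {1..q}" and m: "m > 0" and b: "[b = int m - int r] (mod int q)"
  shows "(\<Sum>i \<in> {i \<in> {1..m - 1}. [int i = b] (mod int q)}. real i powr k)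
         = real m powr k * power_sum_ratio q r m k"
proof -
  have "(\<Sum>i \<in> {i \<in> {1..m - 1}. [int i = b] (mod int q)}. real i powr k)
        = (\<Sum>j | r + q * j < m. real (m - (r + q * j)) powr k)"
  proof (rule sum.reindex_bij_witness[of _ "\<lambda>j. m - (r + q * j)" "\<lambda>i. (m - r - i) div q"])
    fix i assume "i \<in> {i \<in> {1..m - 1}. [int i = b] (mod int q)}"
    then have i: "1 \<le> i" "i < m" and "[int i = b] (mod int q)" using m by auto
    with b have "[int i = int m - int r] (mod int q)" by (blast intro: cong_trans)
    then have "int q dvd int m - int r - int i"
      by (metis cong_iff_dvd_diff cong_sym)
    then obtain t where t: "int m - int r - int i = int q * t" by blast
    \<comment> \<open>If t \<le> -1, then i \<ge> m + q - r \<ge> m by r \<le> q, contradicting i <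
      m.\<close>
    have "t > -1"
    proof (rule ccontr)
      assume "\<not> t > -1"
      then have "int q * t \<le> int q * (-1)" by (intro mult_left_mono) auto
      then show False using t i r by auto
    qed
    then obtain j where "t = int j" by (cases t) auto
    then have "int m = int (r + i + q * j)" using t by simp
    then have j: "m = r + i + q * j" by (simp only: of_nat_eq_iff)
    then have "(m - r - i) div q = j" using q by simp
    with j i show "m - (r + q * ((m - r - i) div q)) = i" "(m - r - i) div q \<in> {j. r + q * j < m}"
      "real (m - (r + q * ((m - r - i) div q))) powr k = real i powr k"
      by auto
  next
    fix j assume "j \<in> {j. r + q * j < m}"
    then have j: "r + q * j < m" by simp
    then show "(m - r - (m - (r + q * j))) div q = j" using q by simp
    have "int (m - (r + q * j)) = int m - int r - int q * int j"
      using j by (simp add: of_nat_diff)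
    then have "[int (m - (r + q * j)) = int m - int r] (mod int q)"
      by (simp add: cong_iff_dvd_diff)
    with b have "[int (m - (r + q * j)) = b] (mod int q)"
      by (blast intro: cong_trans cong_sym)
    then show "m - (r + q * j) \<in> {i \<in> {1..m - 1}. [int i = b] (mod int q)}"
      using j r by auto
  qed
  also have "\<dots> = (\<Sum>j | r + q * j < m. real m powr k * (1 - real (r + q * j) / real m) powr k)"
  proof (intro sum.cong refl)
    fix j assume "j \<in> {j. r + q * j < m}"
    then have j: "r + q * j < m" by simp
    then have d: "real (r + q * j) < real m" by (simp only: of_nat_less_iff)
    have "real (m - (r + q * j)) = real m * (1 - real (r + q * j) / real m)"
      using j m by (simp add: of_nat_diff field_simps)
    moreover have "1 - real (r + q * j) / real m \<ge> 0"
      using d m by (simp add: field_simps)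
    ultimately show "real (m - (r + q * j)) powr k = real m powr k * (1 - real (r + q * j) / real m) powr k"
      by (simp only: powr_mult of_nat_0_le_iff)
  qed
  finally show ?thesis
    by (simp add: power_sum_ratio_sums(2)[OF q m] sum_distrib_left)
qed

theorem theorem1p1:
  fixes q :: nat
  assumes "q \<ge> 1"
  shows "\<exists>C::real. \<forall>(b::int) (m::nat) (k::real) (r::nat).
           m > 0 \<longrightarrow> k > 0 \<longrightarrow>
           (\<Sum>i \<in> {i \<in> {1..m - 1}. [int i = b] (mod int q)}. real i powr k) = real m powr k \<longrightarrow>
           r \<in> {1..q} \<longrightarrow> [b = int m - int r] (mod int q) \<longrightarrow>
           \<bar>k - (c1 q r * real m + c2 q r)\<bar> \<le> C / real m"
proof -
  have "\<forall>r\<in>{1..q}. \<exists>C. \<forall>m k. m > 0 \<longrightarrow> k > 0 \<longrightarrow> power_sum_ratio q r m k = 1 \<longrightarrow>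
           \<bar>k - (c1 q r * real m + c2 q r)\<bar> \<le> C / real m"
    using power_sum_ratio_eq_1_asymp[OF assms] by simp
  then obtain C where C: "\<And>r m k. r \<in> {1..q} \<Longrightarrow> m > 0 \<Longrightarrow> k > 0 \<Longrightarrow> power_sum_ratio q r m k = 1 \<Longrightarrow>
           \<bar>k - (c1 q r * real m + c2 q r)\<bar> \<le> C r / real m"
    by metis
  show ?thesis
  \<comment> \<open>Only finitely many r occur for a given q, so the maximum of their constants
    depends on q alone.\<close>
  proof (intro exI[of _ "Max (C ` {1..q})"] allI impI)
    fix b :: int and m :: nat and k :: real and r :: nat
    assume m: "m > 0" and k: "k > 0" and r: "r \<in> {1..q}" and b: "[b = int m - int r] (mod int q)"
      and eq: "(\<Sum>i \<in> {i \<in> {1..m - 1}. [int i = b] (mod int q)}. real i powr k) = real m powr k"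
    have "power_sum_ratio q r m k = 1"
      using eq m unfolding power_sum_eq_ratio[OF assms r m b] by simp
    then have "\<bar>k - (c1 q r * real m + c2 q r)\<bar> \<le> C r / real m"
      by (rule C[OF r m k])
    also have "\<dots> \<le> Max (C ` {1..q}) / real m"
      using r by (intro divide_right_mono Max_ge) auto
    finally show "\<bar>k - (c1 q r * real m + c2 q r)\<bar> \<le> Max (C ` {1..q}) / real m" .
  qed
qed

end
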